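(* ${\sf GL}$ is strongly complete for the class of $\omega$-bouquets; i.e., every ${\sf GL}$-consistent set of formulae is satisfied at some point of some model based on an $\omega$-bouquet.
   Context: ${\sf GL}$ is the modal logic with axioms $\Box(\varphi\to\psi)\to(\Box\varphi\to\Box\psi)$ and $\Box(\Box\varphi\to\varphi)\to\Box\varphi$ and rules modus ponens and necessitation, over a countable set of propositional variables. Topological ($d$-)semantics: on a space $(X,\tau)$, a valuation $[\![\cdot]\!]$ assigns subsets of $X$ to formulae with $[\![\bot]\!]=\varnothing$, $[\![\neg\varphi]\!]=X\setminus[\![\varphi]\!]$, $[\![\varphi\wedge\psi]\!]=[\![\varphi]\!]\cap[\![\psi]\!]$, $[\![\Diamond\varphi]\!]=d[\![\varphi]\!]$, where $dA$ is the set of limit points of $A$. A tree is a transitive irreflexive relational structure $(T,R)$ in which each predecessor set is well-ordered and there is a unique $R$-minimal element (root); its upset topology $\tau_R$ consists of the upward-closed sets. For a countable converse well-founded tree $(T,R)$ with rank function $\rho$ with respect to $\tau_R$, $\sigma_R$ is the least topology extending $\tau_R$ such that whenever $\rho(w)$ is a limit ordinal, $(v_i)_{i<\omega}$ enumerates all daughters (immediate successors) of $w$ exactly once, and $n<\omega$, the set $\{w\}\cup\bigcup_{n<i}(\{v_i\}\cup R(v_i))$ is in $\sigma_R$. An $\omega$-bouquet is a space $(T,\sigma_R)$ for such a tree $(T,R)$. *)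

theory Defs
  imports "HOL-Analysis.Abstract_Topology" "HOL-Library.Countable_Set"
begin

section \<open>The logic GL\<close>

text \<open>
  The box is taken as primitive and the diamond as its dual. (With the diamond as the primitive
  and the box as an abbreviation, the two axioms would say nothing about formulae such as
  \<open>\<diamond>p\<close>, and an extra duality axiom would be needed.)
\<close>

datatype 'p fm =
    Var 'p
  | Bot
  | Neg "'p fm"
  | Con "'p fm" "'p fm"
  | Box "'p fm"

definition Imp :: "'p fm \<Rightarrow> 'p fm \<Rightarrow> 'p fm" where
  "Imp \<phi> \<psi> = Neg (Con \<phi> (Neg \<psi>))"

definition Dia :: "'p fm \<Rightarrow> 'p fm" where
  "Dia \<phi> = Neg (Box (Neg \<phi>))"

text \<open>Boolean evaluation in which variables and boxed formulae are the atoms.\<close>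

primrec bool_eval :: "('p fm \<Rightarrow> bool) \<Rightarrow> 'p fm \<Rightarrow> bool" where
  "bool_eval h (Var p) = h (Var p)"
| "bool_eval h Bot = False"
| "bool_eval h (Neg \<phi>) = (\<not> bool_eval h \<phi>)"
| "bool_eval h (Con \<phi> \<psi>) = (bool_eval h \<phi> \<and> bool_eval h \<psi>)"
| "bool_eval h (Box \<phi>) = h (Box \<phi>)"

definition tautology :: "'p fm \<Rightarrow> bool" where
  "tautology \<phi> \<longleftrightarrow> (\<forall>h. bool_eval h \<phi>)"

inductive GL :: "'p fm \<Rightarrow> bool" where
  taut: "tautology \<phi> \<Longrightarrow> GL \<phi>"
| K: "GL (Imp (Box (Imp \<phi> \<psi>)) (Imp (Box \<phi>) (Box \<psi>)))"
| Loeb: "GL (Imp (Box (Imp (Box \<phi>) \<phi>)) (Box \<phi>))"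
| MP: "GL (Imp \<phi> \<psi>) \<Longrightarrow> GL \<phi> \<Longrightarrow> GL \<psi>"
| Nec: "GL \<phi> \<Longrightarrow> GL (Box \<phi>)"

primrec Conj :: "'p fm list \<Rightarrow> 'p fm" where
  "Conj [] = Neg Bot"
| "Conj (\<phi> # \<phi>s) = Con \<phi> (Conj \<phi>s)"

definition GL_consistent :: "'p fm set \<Rightarrow> bool" where
  "GL_consistent \<Gamma> \<longleftrightarrow> \<not> (\<exists>\<phi>s. set \<phi>s \<subseteq> \<Gamma> \<and> GL (Imp (Conj \<phi>s) Bot))"


section \<open>Topological semantics\<close>

definition d_valuation :: "'a topology \<Rightarrow> ('p \<Rightarrow> 'a set) \<Rightarrow> bool" where
  "d_valuation X V \<longleftrightarrow> (\<forall>p. V p \<subseteq> topspace X)"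

primrec d_sem :: "'a topology \<Rightarrow> ('p \<Rightarrow> 'a set) \<Rightarrow> 'p fm \<Rightarrow> 'a set" where
  "d_sem X V (Var p) = V p"
| "d_sem X V Bot = {}"
| "d_sem X V (Neg \<phi>) = topspace X - d_sem X V \<phi>"
| "d_sem X V (Con \<phi> \<psi>) = d_sem X V \<phi> \<inter> d_sem X V \<psi>"
| "d_sem X V (Box \<phi>) = topspace X - X derived_set_of (topspace X - d_sem X V \<phi>)"

lemma d_sem_subset: "d_valuation X V \<Longrightarrow> d_sem X V \<phi> \<subseteq> topspace X"
  by (induction \<phi>) (auto simp: d_valuation_def)

lemma d_sem_Dia:
  assumes "d_valuation X V"
  shows "d_sem X V (Dia \<phi>) = X derived_set_of (d_sem X V \<phi>)"
  using d_sem_subset[OF assms, of \<phi>] derived_set_of_subset_topspace[of X "d_sem X V \<phi>"]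
  by (simp add: Dia_def double_diff)


section \<open>Countable ordinals and rank\<close>

text \<open>
  The type of countable ordinals, with order type \<open>\<omega>\<^sub>1\<close>. It is used for the ranks of points of
  countable scattered spaces, which are countable ordinals.
\<close>

typedef cord = "Field (cardSuc natLeq)"
proof -
  have "\<not> finite (Field (cardSuc natLeq))"
    using cardSuc_finite[OF natLeq_Card_order] by (simp add: Field_natLeq)
  then show ?thesis
    by (metis ex_in_conv finite.emptyI)
qed

instantiation cord :: wellorder
begin

definition less_eq_cord :: "cord \<Rightarrow> cord \<Rightarrow> bool" where
  "\<alpha> \<le> \<beta> \<longleftrightarrow> (Rep_cord \<alpha>, Rep_cord \<beta>) \<in> cardSuc natLeq"

definition less_cord :: "cord \<Rightarrow> cord \<Rightarrow> bool" where
  "\<alpha> < \<beta> \<longleftrightarrow> \<alpha> \<le> \<beta> \<and> \<not> \<beta> \<le> (\<alpha>::cord)"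

instance
proof -
  let ?r = "cardSuc natLeq"
  have wo: "Well_order ?r"
    using cardSuc_Card_order[OF natLeq_Card_order] card_order_on_well_order_on by blast
  then have refl: "refl_on (Field ?r) ?r" and tr: "trans ?r" and anti: "antisym ?r"
    and tot: "total_on (Field ?r) ?r" and wf: "wf (?r - Id)"
    by (auto simp: order_on_defs)
  have refl': "\<alpha> \<le> \<alpha>" for \<alpha> :: cord
    using refl Rep_cord by (auto simp: less_eq_cord_def refl_on_def)
  have anti': "\<alpha> = \<beta>" if "\<alpha> \<le> \<beta>" "\<beta> \<le> \<alpha>" for \<alpha> \<beta> :: cord
    using that anti unfolding less_eq_cord_def by (metis antisymD Rep_cord_inject)
  show "OFCLASS(cord, wellorder_class)"
  proof
    fix \<alpha> \<beta> \<gamma> :: cord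
    show "\<alpha> < \<beta> \<longleftrightarrow> \<alpha> \<le> \<beta> \<and> \<not> \<beta> \<le> \<alpha>"
      by (rule less_cord_def)
    show "\<alpha> \<le> \<alpha>"
      by (rule refl')
    show "\<alpha> \<le> \<gamma>" if "\<alpha> \<le> \<beta>" "\<beta> \<le> \<gamma>"
      using that tr by (auto simp: less_eq_cord_def dest: transD)
    show "\<alpha> = \<beta>" if "\<alpha> \<le> \<beta>" "\<beta> \<le> \<alpha>"
      using that by (rule anti')
    show "\<alpha> \<le> \<beta> \<or> \<beta> \<le> \<alpha>"
      using tot refl' Rep_cord[of \<alpha>] Rep_cord[of \<beta>]
      by (cases "\<alpha> = \<beta>") (auto simp: less_eq_cord_def total_on_def Rep_cord_inject)
  next
    fix P :: "cord \<Rightarrow> bool" and \<alpha> :: cord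
    assume step: "\<And>\<alpha>. (\<And>\<beta>. \<beta> < \<alpha> \<Longrightarrow> P \<beta>) \<Longrightarrow> P \<alpha>"
    have "wf (inv_image (?r - Id) Rep_cord)"
      using wf by (rule wf_inv_image)
    then show "P \<alpha>"
    proof (induction \<alpha> rule: wf_induct_rule)
      case (less \<alpha>)
      show ?case
      proof (rule step)
        fix \<beta> assume "\<beta> < \<alpha>"
        then have "(\<beta>, \<alpha>) \<in> inv_image (?r - Id) Rep_cord"
          by (auto simp: less_cord_def less_eq_cord_def)
        then show "P \<beta>"
          by (rule less)
      qed
    qed
  qed
qed

end

lemma countable_cord_bounded:
  fixes A :: "cord set"
  assumes "countable A"
  shows "\<exists>\<beta>. \<forall>\<alpha>\<in>A. \<alpha> < \<beta>"
proof -
  let ?r = "cardSuc natLeq"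
  have inf: "\<not> finite (Field natLeq)" and co: "Card_order ?r"
    using cardSuc_Card_order[OF natLeq_Card_order] by (simp_all add: Field_natLeq)
  then have inf': "\<not> finite (Field ?r)"
    using cardSuc_finite[OF natLeq_Card_order] by simp
  have wo: "Well_order ?r"
    using co card_order_on_well_order_on by blast
  then have refl: "refl_on (Field ?r) ?r" and tr: "trans ?r"
    by (auto simp: order_on_defs)
  let ?As = "\<lambda>i. {x. (x, i) \<in> ?r}"
  have "countable (Rep_cord ` A)"
    using assms by simp
  then have "(card_of (Rep_cord ` A), natLeq) \<in> ordLeq"
    using card_of_ordLeq[of "Rep_cord ` A" "UNIV :: nat set"] ordLeq_ordIso_trans[OF _ card_of_nat]
    unfolding countable_def by (metis subset_UNIV)
  moreover have "relChain ?r ?As"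
    using tr unfolding relChain_def trans_def by blast
  moreover have "Rep_cord ` A \<subseteq> (\<Union>i\<in>Field ?r. ?As i)"
    using refl Rep_cord by (auto simp: refl_on_def)
  ultimately obtain i where i: "i \<in> Field ?r" "Rep_cord ` A \<subseteq> ?As i"
    using cardSuc_UNION[OF natLeq_Card_order inf, of ?As "Rep_cord ` A"] by blast
  obtain j where j: "j \<in> Field ?r" "i \<noteq> j" "(i, j) \<in> ?r"
    using infinite_Card_order_limit[OF co inf' i(1)] by blast
  have "\<alpha> \<le> Abs_cord i" if "\<alpha> \<in> A" for \<alpha>
    using that i by (auto simp: less_eq_cord_def Abs_cord_inverse)
  moreover have "Abs_cord i \<le> Abs_cord j" "Abs_cord i \<noteq> Abs_cord j"
    using i j by (auto simp: less_eq_cord_def Abs_cord_inverse Abs_cord_inject)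
  ultimately show ?thesis
    by (meson order_le_imp_less_or_eq order_le_less_trans)
qed

definition limit_ordinal :: "'o::wellorder \<Rightarrow> bool" where
  "limit_ordinal \<alpha> \<longleftrightarrow> (\<exists>\<beta>. \<beta> < \<alpha>) \<and> (\<forall>\<beta><\<alpha>. \<exists>\<gamma>. \<beta> < \<gamma> \<and> \<gamma> < \<alpha>)"

text \<open>
  The Cantor--Bendixson sequence \<open>d\<^sup>\<alpha>X\<close>. The usual zero, successor and limit clauses are
  derived below.
\<close>

function cb_seq :: "'a topology \<Rightarrow> 'o::wellorder \<Rightarrow> 'a set" where
  "cb_seq X \<alpha> = topspace X \<inter> (\<Inter>\<beta>\<in>{..<\<alpha>}. X derived_set_of (cb_seq X \<beta>))"
  by auto
termination
  by (relation "inv_image {(\<beta>, \<alpha>). \<beta> < \<alpha>} snd") (auto intro: wf_inv_image wf)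

declare cb_seq.simps [simp del]

lemma cb_seq_antimono: "\<alpha> \<le> \<beta> \<Longrightarrow> cb_seq X \<beta> \<subseteq> cb_seq X \<alpha>"
  by (subst (1 2) cb_seq.simps) auto

lemma cb_seq_zero:
  assumes "\<And>\<beta>. \<not> \<beta> < \<alpha>"
  shows "cb_seq X \<alpha> = topspace X"
  using assms by (subst cb_seq.simps) auto

lemma cb_seq_succ:
  assumes "\<alpha> < \<beta>" and "\<And>\<gamma>. \<gamma> < \<beta> \<Longrightarrow> \<gamma> \<le> \<alpha>"
  shows "cb_seq X \<beta> = X derived_set_of (cb_seq X \<alpha>)"
proof
  show "cb_seq X \<beta> \<subseteq> X derived_set_of (cb_seq X \<alpha>)"
    using assms by (subst cb_seq.simps) auto
  show "X derived_set_of (cb_seq X \<alpha>) \<subseteq> cb_seq X \<beta>"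
    using derived_set_of_mono[OF cb_seq_antimono[OF assms(2)], of _ X]
      derived_set_of_subset_topspace[of X "cb_seq X \<alpha>"]
    by (subst (2) cb_seq.simps) auto
qed

lemma cb_seq_limit:
  assumes "limit_ordinal \<alpha>"
  shows "cb_seq X \<alpha> = (\<Inter>\<beta>\<in>{..<\<alpha>}. cb_seq X \<beta>)"
proof
  show "cb_seq X \<alpha> \<subseteq> (\<Inter>\<beta>\<in>{..<\<alpha>}. cb_seq X \<beta>)"
    by (intro INT_greatest cb_seq_antimono) auto
  show "(\<Inter>\<beta>\<in>{..<\<alpha>}. cb_seq X \<beta>) \<subseteq> cb_seq X \<alpha>"
  proof
    fix x assume x: "x \<in> (\<Inter>\<beta>\<in>{..<\<alpha>}. cb_seq X \<beta>)"
    have "x \<in> X derived_set_of (cb_seq X \<beta>)" if less: "\<beta> < \<alpha>" for \<beta>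
    proof -
      obtain \<gamma> where "\<beta> < \<gamma>" "\<gamma> < \<alpha>"
        using assms less unfolding limit_ordinal_def by blast
      then have "x \<in> cb_seq X \<gamma>"
        using x by blast
      then show ?thesis
        using \<open>\<beta> < \<gamma>\<close> unfolding cb_seq.simps[of X \<gamma>] by blast
    qed
    moreover obtain \<beta> where "\<beta> < \<alpha>"
      using assms unfolding limit_ordinal_def by blast
    ultimately show "x \<in> cb_seq X \<alpha>"
      using derived_set_of_subset_topspace[of X "cb_seq X \<beta>"]
      unfolding cb_seq.simps[of X \<alpha>] by blast
  qed
qed

text \<open>The least \<open>\<alpha>\<close> such that \<open>x \<notin> d\<^sup>\<alpha>\<^sup>+\<^sup>1X\<close>.\<close>

definition cb_rank :: "'a topology \<Rightarrow> 'a \<Rightarrow> cord" where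
  "cb_rank X x = (LEAST \<alpha>. x \<notin> X derived_set_of (cb_seq X \<alpha>))"


section \<open>Bouquets\<close>

definition tree :: "'a set \<Rightarrow> 'a rel \<Rightarrow> bool" where
  "tree T R \<longleftrightarrow> R \<subseteq> T \<times> T \<and> trans R \<and> irrefl R \<and>
     (\<forall>w\<in>T. let P = {v. (v, w) \<in> R} in well_order_on P (Restr (R\<^sup>=) P)) \<and>
     (\<exists>!r. r \<in> T \<and> (\<forall>v. (v, r) \<notin> R))"

definition upset_topology :: "'a set \<Rightarrow> 'a rel \<Rightarrow> 'a topology" where
  "upset_topology T R = topology (\<lambda>U. U \<subseteq> T \<and> (\<forall>v w. v \<in> U \<and> (v, w) \<in> R \<longrightarrow> w \<in> U))"

lemma openin_upset_topology:
  "openin (upset_topology T R) U \<longleftrightarrow> U \<subseteq> T \<and> (\<forall>v w. v \<in> U \<and> (v, w) \<in> R \<longrightarrow> w \<in> U)"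
proof -
  have "istopology (\<lambda>U. U \<subseteq> T \<and> (\<forall>v w. v \<in> U \<and> (v, w) \<in> R \<longrightarrow> w \<in> U))"
    unfolding istopology_def by blast
  then show ?thesis
    by (simp add: upset_topology_def topology_inverse')
qed

definition daughters :: "'a rel \<Rightarrow> 'a \<Rightarrow> 'a set" where
  "daughters R w = {v. (w, v) \<in> R \<and> \<not> (\<exists>u. (w, u) \<in> R \<and> (u, v) \<in> R)}"

definition bouquet_topology :: "'a set \<Rightarrow> 'a rel \<Rightarrow> 'a topology" where
  "bouquet_topology T R = topology_generated_by
     ({U. openin (upset_topology T R) U} \<union>
      {{w} \<union> (\<Union>i\<in>{n<..}. {v i} \<union> R `` {v i}) | w n (v :: nat \<Rightarrow> 'a).
         w \<in> T \<and> limit_ordinal (cb_rank (upset_topology T R) w) \<and>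
         bij_betw v UNIV (daughters R w)})"

definition omega_bouquet :: "'a topology \<Rightarrow> bool" where
  "omega_bouquet X \<longleftrightarrow>
     (\<exists>T R. countable T \<and> tree T R \<and> wf (R\<inverse>) \<and> X = bouquet_topology T R)"

lemma topspace_bouquet_topology:
  assumes "tree T R"
  shows "topspace (bouquet_topology T R) = T"
proof -
  have RT: "R \<subseteq> T \<times> T"
    using assms by (simp add: tree_def)
  have "openin (upset_topology T R) T"
    using RT by (auto simp: openin_upset_topology)
  moreover have "U \<subseteq> T" if "openin (upset_topology T R) U" for U
    using that by (simp add: openin_upset_topology)
  moreover have "v i \<in> T" if "bij_betw v UNIV (daughters R w)" for v :: "nat \<Rightarrow> 'a" and w i
    using that RT by (auto simp: daughters_def bij_betw_def)
  ultimately show ?thesis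
    unfolding bouquet_topology_def topology_generated_by_topspace using RT by blast
qed

text \<open>
  On a countable converse well-founded tree every point has a rank below \<open>\<omega>\<^sub>1\<close>, so the
  least element in the definition of the rank exists.
\<close>

lemma cb_rank_exists:
  assumes "countable T" and "tree T R" and "wf (R\<inverse>)"
  shows "\<exists>\<alpha>::cord. w \<notin> upset_topology T R derived_set_of (cb_seq (upset_topology T R) \<alpha>)"
  using assms(3)
proof (induction w rule: wf_induct_rule)
  case (less w)
  let ?X = "upset_topology T R"
  have RT: "R \<subseteq> T \<times> T" and tr: "trans R"
    using assms(2) by (auto simp: tree_def)
  obtain f :: "'a \<Rightarrow> cord" where f: "\<And>v. (w, v) \<in> R \<Longrightarrow> v \<notin> ?X derived_set_of (cb_seq ?X (f v))"
    using less by (metis converseI)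
  have "countable (R `` {w})"
    using RT assms(1) by (auto intro!: countable_subset[of "R `` {w}" T])
  then obtain \<beta> where \<beta>: "\<And>v. (w, v) \<in> R \<Longrightarrow> f v < \<beta>"
    using countable_cord_bounded[of "f ` (R `` {w})"] by auto
  have no: "v \<notin> cb_seq ?X \<beta>" if "(w, v) \<in> R" for v
    using f[OF that] \<beta>[OF that] by (subst cb_seq.simps) auto
  have "w \<notin> ?X derived_set_of (cb_seq ?X \<beta>)"
  proof
    assume *: "w \<in> ?X derived_set_of (cb_seq ?X \<beta>)"
    then have "w \<in> T"
      using derived_set_of_subset_topspace[of ?X] openin_topspace[of ?X]
      unfolding openin_upset_topology by blast
    then have "openin ?X ({w} \<union> R `` {w})"
      using RT tr unfolding openin_upset_topology trans_def by blast
    with * obtain y where "y \<noteq> w" "y \<in> cb_seq ?X \<beta>" "y \<in> {w} \<union> R `` {w}"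
      unfolding in_derived_set_of by blast
    then show False
      using no by auto
  qed
  then show ?case
    by blast
qed

end

theory Submission
  imports Defs "HOL-Library.Sublist"
begin

text \<open>
  Extend the given set to a maximal consistent set \<open>\<Gamma>\<close>. If \<open>\<Gamma>\<close> contains \<open>\<box>\<^sup>k\<bottom>\<close> for some \<open>k\<close>,
  the canonical model above \<open>\<Gamma>\<close>, unravelled, is a tree of finite height. All ranks are then finite
  and the bouquet topology is the upset topology, so the truth lemma is the relational one.
  Otherwise, for every \<open>n\<close>, unravelling with witnesses only for a finite fragment \<open>F\<^sub>n\<close> gives a
  finite tree with root \<open>\<Gamma>\<close> whose truth lemma holds for \<open>F\<^sub>n\<close>; its height is finite because a
  boxed formula may be added to the label together with its witness, by Loeb's axiom. Glue these
  trees at their common root. The height is unbounded, so the root has limit rank, and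
  its neighbourhoods contain all but finitely many of the daughters. If \<open>\<box>\<phi> \<in> \<Gamma>\<close>, dropping the
  finitely many trees with \<open>\<phi> \<notin> F\<^sub>n\<close> leaves a neighbourhood where \<open>\<phi>\<close> holds; if \<open>\<box>\<phi> \<notin> \<Gamma>\<close>,
  almost every tree provides a daughter refuting \<open>\<phi>\<close>.
\<close>

section \<open>Maximal consistent sets\<close>

text \<open>An enumeration of the formulae defines the finite fragments and codes witness sequences
  as natural numbers.\<close>

instance fm :: (countable) countable
  by countable_datatype

section \<open>Derivations in GL\<close>

lemma bool_eval_Imp [simp]: "bool_eval h (Imp \<phi> \<psi>) \<longleftrightarrow> (bool_eval h \<phi> \<longrightarrow> bool_eval h \<psi>)"
  by (auto simp: Imp_def)

lemma bool_eval_Conj [simp]: "bool_eval h (Conj \<phi>s) \<longleftrightarrow> (\<forall>\<phi>\<in>set \<phi>s. bool_eval h \<phi>)"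
  by (induction \<phi>s) auto

lemma GL_consequence:
  assumes "GL \<phi>" and "\<And>h. bool_eval h \<phi> \<Longrightarrow> bool_eval h \<psi>"
  shows "GL \<psi>"
  using assms GL.MP[OF GL.taut, of \<phi> \<psi>] by (auto simp: tautology_def)

lemma GL_consequence2:
  assumes "GL \<phi>" "GL \<psi>" and "\<And>h. bool_eval h \<phi> \<Longrightarrow> bool_eval h \<psi> \<Longrightarrow> bool_eval h \<chi>"
  shows "GL \<chi>"
proof -
  have "GL (Imp \<psi> \<chi>)"
    by (rule GL_consequence[OF assms(1)]) (use assms(3) in auto)
  then show ?thesis
    using assms(2) by (rule GL.MP)
qed

lemma GL_Box_mono:
  assumes "GL (Imp \<phi> \<psi>)"
  shows "GL (Imp (Box \<phi>) (Box \<psi>))"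
  using GL.MP[OF GL.K GL.Nec[OF assms]] .

text \<open>Transitivity follows by applying Loeb's axiom to \<open>\<phi> \<and> \<box>\<phi>\<close>.\<close>

lemma GL_4: "GL (Imp (Box \<phi>) (Box (Box \<phi>)))"
proof -
  let ?\<theta> = "Con \<phi> (Box \<phi>)"
  have fst: "GL (Imp (Box ?\<theta>) (Box \<phi>))" and snd: "GL (Imp (Box ?\<theta>) (Box (Box \<phi>)))"
    by (rule GL_Box_mono, rule GL.taut, simp add: tautology_def)+
  \<comment> \<open>Given \<phi>, only \<open>Box \<phi>\<close> is missing from
    \<open>?\<theta>\<close>, and \<open>fst\<close> extracts it from
    \<open>Box ?\<theta>\<close>.\<close>
  have "GL (Imp \<phi> (Imp (Box ?\<theta>) ?\<theta>))"
    by (rule GL_consequence[OF fst]) auto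
  then have "GL (Imp (Box \<phi>) (Box (Imp (Box ?\<theta>) ?\<theta>)))"
    by (rule GL_Box_mono)
  from this GL.Loeb have "GL (Imp (Box \<phi>) (Box ?\<theta>))"
    by (rule GL_consequence2) auto
  from this snd show ?thesis
    by (rule GL_consequence2) auto
qed

section \<open>Derivability from sets of formulae\<close>

definition derivable :: "'p fm set \<Rightarrow> 'p fm \<Rightarrow> bool" where
  "derivable \<Gamma> \<phi> \<longleftrightarrow> (\<exists>\<phi>s. set \<phi>s \<subseteq> \<Gamma> \<and> GL (Imp (Conj \<phi>s) \<phi>))"

lemma GL_consistent_iff: "GL_consistent \<Gamma> \<longleftrightarrow> \<not> derivable \<Gamma> Bot"
  by (simp add: GL_consistent_def derivable_def)

lemma derivable_GL: "GL \<phi> \<Longrightarrow> derivable \<Gamma> \<phi>"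
  unfolding derivable_def
  by (rule exI[of _ "[]"]) (auto elim: GL_consequence)

lemma derivable_assumption: "\<phi> \<in> \<Gamma> \<Longrightarrow> derivable \<Gamma> \<phi>"
  unfolding derivable_def
  by (rule exI[of _ "[\<phi>]"]) (auto intro: GL.taut simp: tautology_def)

lemma derivable_consequence2:
  assumes "derivable \<Gamma> \<phi>" "derivable \<Gamma> \<psi>"
    and "\<And>h. bool_eval h \<phi> \<Longrightarrow> bool_eval h \<psi> \<Longrightarrow> bool_eval h \<chi>"
  shows "derivable \<Gamma> \<chi>"
proof -
  obtain xs ys where sub: "set xs \<subseteq> \<Gamma>" "set ys \<subseteq> \<Gamma>"
    and der: "GL (Imp (Conj xs) \<phi>)" "GL (Imp (Conj ys) \<psi>)"
    using assms(1,2) unfolding derivable_def by blast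
  from der have "GL (Imp (Conj (xs @ ys)) \<chi>)"
    by (rule GL_consequence2) (use assms(3) in auto)
  with sub show ?thesis
    unfolding derivable_def by (intro exI[of _ "xs @ ys"]) auto
qed

lemma derivable_consequence:
  assumes "derivable \<Gamma> \<phi>" and "\<And>h. bool_eval h \<phi> \<Longrightarrow> bool_eval h \<psi>"
  shows "derivable \<Gamma> \<psi>"
  using assms(1,1) by (rule derivable_consequence2) (rule assms(2))

text \<open>Necessitation applies to theorems only, so a premise acts as a propositional antecedent.
  Deleting every occurrence of \<phi> from the list leaves premises from \<Gamma>.\<close>

lemma derivable_deduction:
  assumes "derivable (insert \<phi> \<Gamma>) \<psi>"
  shows "derivable \<Gamma> (Imp \<phi> \<psi>)"
proof -
  obtain xs where xs: "set xs \<subseteq> insert \<phi> \<Gamma>" "GL (Imp (Conj xs) \<psi>)"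
    using assms unfolding derivable_def by blast
  have "GL (Imp (Conj (filter (\<lambda>\<chi>. \<chi> \<noteq> \<phi>) xs)) (Imp \<phi> \<psi>))"
    by (rule GL_consequence[OF xs(2)]) auto
  then show ?thesis
    using xs(1) unfolding derivable_def by (intro exI[of _ "filter (\<lambda>\<chi>. \<chi> \<noteq> \<phi>) xs"]) auto
qed

section \<open>Maximal consistent sets and Lindenbaum's lemma\<close>

definition MCS :: "'p fm set \<Rightarrow> bool" where
  "MCS \<Gamma> \<longleftrightarrow> GL_consistent \<Gamma> \<and> (\<forall>\<phi>. \<phi> \<in> \<Gamma> \<or> Neg \<phi> \<in> \<Gamma>)"

lemma MCS_derivable:
  assumes "MCS \<Gamma>" "derivable \<Gamma> \<phi>"
  shows "\<phi> \<in> \<Gamma>"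
proof (rule ccontr)
  assume "\<phi> \<notin> \<Gamma>"
  then have "derivable \<Gamma> (Neg \<phi>)"
    using assms(1) by (auto simp: MCS_def intro: derivable_assumption)
  with assms(2) have "derivable \<Gamma> Bot"
    by (rule derivable_consequence2) auto
  then show False
    using assms(1) by (simp add: MCS_def GL_consistent_iff)
qed

lemma MCS_GL: "MCS \<Gamma> \<Longrightarrow> GL \<phi> \<Longrightarrow> \<phi> \<in> \<Gamma>"
  by (simp add: MCS_derivable derivable_GL)

lemma MCS_MP:
  assumes "MCS \<Gamma>" "Imp \<phi> \<psi> \<in> \<Gamma>" "\<phi> \<in> \<Gamma>"
  shows "\<psi> \<in> \<Gamma>"
  using derivable_consequence2[OF assms(2,3)[THEN derivable_assumption], of \<psi>]
  by (intro MCS_derivable[OF assms(1)]) auto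

lemma MCS_Bot: "MCS \<Gamma> \<Longrightarrow> Bot \<notin> \<Gamma>"
  by (auto simp: MCS_def GL_consistent_iff intro: derivable_assumption)

lemma MCS_Neg:
  assumes "MCS \<Gamma>"
  shows "Neg \<phi> \<in> \<Gamma> \<longleftrightarrow> \<phi> \<notin> \<Gamma>"
proof -
  have "derivable \<Gamma> Bot" if "Neg \<phi> \<in> \<Gamma>" "\<phi> \<in> \<Gamma>"
    using that[THEN derivable_assumption] by (rule derivable_consequence2) auto
  then show ?thesis
    using assms by (auto simp: MCS_def GL_consistent_iff)
qed

lemma MCS_Con:
  assumes "MCS \<Gamma>"
  shows "Con \<phi> \<psi> \<in> \<Gamma> \<longleftrightarrow> \<phi> \<in> \<Gamma> \<and> \<psi> \<in> \<Gamma>"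
proof -
  have 1: "derivable \<Gamma> \<phi>" "derivable \<Gamma> \<psi>" if "Con \<phi> \<psi> \<in> \<Gamma>"
    by (rule derivable_consequence[OF derivable_assumption[OF that]]; simp)+
  have 2: "derivable \<Gamma> (Con \<phi> \<psi>)" if "\<phi> \<in> \<Gamma>" "\<psi> \<in> \<Gamma>"
    using that[THEN derivable_assumption] by (rule derivable_consequence2) auto
  show ?thesis
    using 1 2 MCS_derivable[OF assms] by blast
qed

text \<open>Consistency has finite character, so it passes to unions of chains and Zorn's lemma
  applies.\<close>

lemma Lindenbaum:
  assumes "GL_consistent \<Gamma>"
  shows "\<exists>\<Delta>. \<Gamma> \<subseteq> \<Delta> \<and> MCS \<Delta>"
proof -
  let ?A = "{\<Delta>. \<Gamma> \<subseteq> \<Delta> \<and> GL_consistent \<Delta>}"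
  have "\<exists>M\<in>?A. \<forall>X\<in>?A. M \<subseteq> X \<longrightarrow> X = M"
  proof (rule subset_Zorn_nonempty)
    show "?A \<noteq> {}"
      using assms by auto
    fix C assume C: "C \<noteq> {}" "subset.chain ?A C"
    have "GL_consistent (\<Union>C)"
      unfolding GL_consistent_def
    proof clarify
      fix xs assume xs: "set xs \<subseteq> \<Union>C" "GL (Imp (Conj xs) Bot)"
      obtain \<Delta> where "\<Delta> \<in> C" "set xs \<subseteq> \<Delta>"
        using finite_subset_Union_chain[OF finite_set xs(1) C] by blast
      then show False
        using xs(2) C(2) by (auto simp: subset.chain_def GL_consistent_def)
    qed
    moreover have "\<Gamma> \<subseteq> \<Union>C"
    proof -
      from C(1) obtain \<Delta> where "\<Delta> \<in> C"
        by blast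
      then show ?thesis
        using C(2) unfolding subset.chain_def by blast
    qed
    ultimately show "\<Union>C \<in> ?A"
      by simp
  qed
  then obtain M where M: "M \<in> ?A" "\<forall>X\<in>?A. M \<subseteq> X \<longrightarrow> X = M" ..
  then have max: "X = M" if "GL_consistent X" "M \<subseteq> X" for X
    using that by auto
  have "\<phi> \<in> M \<or> Neg \<phi> \<in> M" for \<phi>
  proof (rule ccontr)
    assume "\<not> ?thesis"
    then have "\<not> GL_consistent (insert \<phi> M)" "\<not> GL_consistent (insert (Neg \<phi>) M)"
      using max by blast+
    then have "derivable M (Imp \<phi> Bot)" "derivable M (Imp (Neg \<phi>) Bot)"
      by (auto simp: GL_consistent_iff intro: derivable_deduction)
    then have "derivable M Bot"
      by (rule derivable_consequence2) auto
    then show False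
      using M(1) by (simp add: GL_consistent_iff)
  qed
  then show ?thesis
    using M(1) by (auto simp: MCS_def)
qed

section \<open>Boxes and canonical successors\<close>

lemma MCS_Box_derivable:
  assumes "MCS \<Delta>" "\<And>\<chi>. \<chi> \<in> D \<Longrightarrow> Box \<chi> \<in> \<Delta>" "derivable D \<phi>"
  shows "Box \<phi> \<in> \<Delta>"
proof -
  obtain xs where "set xs \<subseteq> D" "GL (Imp (Conj xs) \<phi>)"
    using assms(3) unfolding derivable_def by blast
  then show ?thesis
  proof (induction xs arbitrary: \<phi>)
    case Nil
    then have "GL \<phi>"
      by (auto elim: GL_consequence)
    then show ?case
      by (intro MCS_GL[OF assms(1)] GL.Nec)
  next
    case (Cons \<chi> xs)
    \<comment> \<open>Moving one premise into the conclusion shortens the list; axiom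
      \<open>K\<close> takes it out again under the box.\<close>
    have "GL (Imp (Conj xs) (Imp \<chi> \<phi>))"
      by (rule GL_consequence[OF Cons.prems(2)]) auto
    then have "Box (Imp \<chi> \<phi>) \<in> \<Delta>"
      using Cons by simp
    moreover have "Box \<chi> \<in> \<Delta>"
      using Cons.prems(1) assms(2) by simp
    ultimately show ?case
      using MCS_MP[OF assms(1)] MCS_GL[OF assms(1) GL.K] by blast
  qed
qed

text \<open>The clause on \<chi> is that of a transitive canonical relation. The clause
  \<open>Box \<psi> \<in> \<Theta>\<close> is Loeb's: a refuted box becomes true at its witness, so
  it is not refuted again further up.\<close>

definition canonical_successor :: "'p fm set \<Rightarrow> 'p fm \<Rightarrow> 'p fm set \<Rightarrow> bool" where
  "canonical_successor \<Delta> \<psi> \<Theta> \<longleftrightarrow>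
     MCS \<Theta> \<and> (\<forall>\<chi>. Box \<chi> \<in> \<Delta> \<longrightarrow> \<chi> \<in> \<Theta> \<and> Box \<chi> \<in> \<Theta>) \<and> \<psi> \<notin> \<Theta> \<and> Box \<psi> \<in> \<Theta>"

text \<open>Were the required set inconsistent, \<open>D\<close> would derive
  \<open>Imp (Box \<psi>) \<psi>\<close>. By transitivity every member of \<open>D\<close> is boxed
  in \<Delta>, so the box of this implication lies in \<Delta> and Loeb's axiom puts
  \<open>Box \<psi>\<close> there.\<close>

lemma canonical_successor_exists:
  assumes "MCS \<Delta>" "Box \<psi> \<notin> \<Delta>"
  shows "\<exists>\<Theta>. canonical_successor \<Delta> \<psi> \<Theta>"
proof -
  define D where "D = {\<chi>. Box \<chi> \<in> \<Delta>} \<union> Box ` {\<chi>. Box \<chi> \<in> \<Delta>}"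
  let ?S = "insert (Neg \<psi>) (insert (Box \<psi>) D)"
  have D: "Box \<chi> \<in> \<Delta>" if "\<chi> \<in> D" for \<chi>
    using that MCS_MP[OF assms(1) MCS_GL[OF assms(1) GL_4]] by (auto simp: D_def)
  have "GL_consistent ?S"
    unfolding GL_consistent_iff
  proof
    assume "derivable ?S Bot"
    then have "derivable D (Imp (Box \<psi>) (Imp (Neg \<psi>) Bot))"
      by (intro derivable_deduction)
    then have "derivable D (Imp (Box \<psi>) \<psi>)"
      by (rule derivable_consequence) auto
    from MCS_Box_derivable[OF assms(1) D this] have "Box \<psi> \<in> \<Delta>"
      using MCS_MP[OF assms(1) MCS_GL[OF assms(1) GL.Loeb]] by blast
    with assms(2) show False ..
  qed
  then obtain \<Theta> where "?S \<subseteq> \<Theta>" "MCS \<Theta>"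
    using Lindenbaum by blast
  then show ?thesis
    unfolding canonical_successor_def D_def by (intro exI[of _ \<Theta>]) (auto simp: MCS_Neg)
qed

definition succ_mcs :: "'p fm set \<Rightarrow> 'p fm \<Rightarrow> 'p fm set" where
  "succ_mcs \<Delta> \<psi> = (SOME \<Theta>. canonical_successor \<Delta> \<psi> \<Theta>)"

lemma canonical_successor_succ_mcs:
  "MCS \<Delta> \<Longrightarrow> Box \<psi> \<notin> \<Delta> \<Longrightarrow> canonical_successor \<Delta> \<psi> (succ_mcs \<Delta> \<psi>)"
  unfolding succ_mcs_def using canonical_successor_exists by (rule someI_ex)

text \<open>Relationally, \<open>Box_power_Bot k\<close> says that no chain of \<open>k\<close>
  steps leads up from the point; for \<open>k = 0\<close> it is \<open>Bot\<close>.\<close>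

abbreviation Box_power_Bot :: "nat \<Rightarrow> 'p fm" where
  "Box_power_Bot k \<equiv> (Box ^^ k) Bot"


section \<open>Ranks and neighbourhoods in bouquets\<close>

locale countable_tree =
  fixes T :: "'a set" and R :: "'a rel"
  assumes countable_T: "countable T" and tree_TR: "tree T R" and wf_conv: "wf (R\<inverse>)"
begin

abbreviation rank :: "'a \<Rightarrow> cord" where
  "rank \<equiv> cb_rank (upset_topology T R)"

lemma R_subset: "(w, v) \<in> R \<Longrightarrow> w \<in> T \<and> v \<in> T"
  and R_trans: "(w, v) \<in> R \<Longrightarrow> (v, u) \<in> R \<Longrightarrow> (w, u) \<in> R"
  and R_irrefl: "(w, w) \<notin> R"
  using tree_TR by (auto simp: tree_def irrefl_def dest: transD)

lemma topspace_upset: "topspace (upset_topology T R) = T"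
proof -
  have "openin (upset_topology T R) T"
    using R_subset by (auto simp: openin_upset_topology)
  moreover have "topspace (upset_topology T R) \<subseteq> T"
    using openin_topspace[of "upset_topology T R"] unfolding openin_upset_topology by blast
  ultimately show ?thesis
    using openin_subset by blast
qed

lemma openin_cone: "w \<in> T \<Longrightarrow> openin (upset_topology T R) ({w} \<union> R `` {w})"
  using R_subset R_trans by (auto simp: openin_upset_topology)

text \<open>The cone at \<open>w\<close> is its least open neighbourhood, and irreflexivity keeps
  the points above \<open>w\<close> distinct from \<open>w\<close>.\<close>

lemma derived_set_of_upset:
  "w \<in> upset_topology T R derived_set_of A \<longleftrightarrow> w \<in> T \<and> (\<exists>v\<in>A. (w, v) \<in> R)"
proof
  assume w: "w \<in> upset_topology T R derived_set_of A"
  then have "w \<in> T"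
    by (simp add: in_derived_set_of topspace_upset)
  with w show "w \<in> T \<and> (\<exists>v\<in>A. (w, v) \<in> R)"
    using openin_cone unfolding in_derived_set_of by blast
next
  assume "w \<in> T \<and> (\<exists>v\<in>A. (w, v) \<in> R)"
  then show "w \<in> upset_topology T R derived_set_of A"
    using R_irrefl unfolding in_derived_set_of topspace_upset openin_upset_topology by metis
qed

lemma cb_seq_iff_le_rank:
  assumes "w \<in> T"
  shows "w \<in> cb_seq (upset_topology T R) \<alpha> \<longleftrightarrow> \<alpha> \<le> rank w"
proof
  assume w: "w \<in> cb_seq (upset_topology T R) \<alpha>"
  \<comment> \<open>The \<open>LEAST\<close> in the rank is attained, by countability and converse
    well-foundedness.\<close>
  have no: "w \<notin> upset_topology T R derived_set_of (cb_seq (upset_topology T R) (rank w))"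
    unfolding cb_rank_def
    using cb_rank_exists[OF countable_T tree_TR wf_conv] by (rule LeastI_ex)
  show "\<alpha> \<le> rank w"
  proof (rule ccontr)
    assume "\<not> \<alpha> \<le> rank w"
    then show False
      using w no unfolding cb_seq.simps[of _ \<alpha>] by auto
  qed
next
  assume "\<alpha> \<le> rank w"
  then have "w \<in> upset_topology T R derived_set_of (cb_seq (upset_topology T R) \<beta>)" if "\<beta> < \<alpha>" for \<beta>
    using that not_less_Least[of \<beta> "\<lambda>\<alpha>. w \<notin> upset_topology T R derived_set_of (cb_seq (upset_topology T R) \<alpha>)"]
    unfolding cb_rank_def by (metis order_less_le_trans)
  then show "w \<in> cb_seq (upset_topology T R) \<alpha>"
    unfolding cb_seq.simps[of _ \<alpha>] using assms by (auto simp: topspace_upset)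
qed

text \<open>A point is a limit point of stage \<alpha> exactly when some point above it has rank at
  least \<alpha>. So the topological rank is the usual rank of a well-founded relation.\<close>

lemma rank_eq_Least:
  assumes "w \<in> T"
  shows "rank w = (LEAST \<alpha>. \<forall>v. (w, v) \<in> R \<longrightarrow> rank v < \<alpha>)"
proof -
  have "w \<notin> upset_topology T R derived_set_of (cb_seq (upset_topology T R) \<alpha>) \<longleftrightarrow>
      (\<forall>v. (w, v) \<in> R \<longrightarrow> rank v < \<alpha>)" for \<alpha>
    using assms cb_seq_iff_le_rank R_subset unfolding derived_set_of_upset
    by (meson not_le)
  then show ?thesis
    unfolding cb_rank_def[of _ w] by simp
qed

lemma rank_le:
  assumes "w \<in> T" "\<And>v. (w, v) \<in> R \<Longrightarrow> rank v < \<alpha>"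
  shows "rank w \<le> \<alpha>"
  unfolding rank_eq_Least[OF assms(1)] by (rule Least_le) (use assms(2) in blast)

text \<open>The \<open>LEAST\<close> is a strict upper bound once one exists: only countably many
  points lie above \<open>w\<close>, and countable sets of countable ordinals are bounded.\<close>

lemma rank_less:
  assumes "(w, v) \<in> R"
  shows "rank v < rank w"
proof -
  have "countable (rank ` (R `` {w}))"
    using R_subset by (intro countable_image countable_subset[OF _ countable_T]) auto
  then obtain \<beta> where "\<forall>\<alpha>\<in>rank ` (R `` {w}). \<alpha> < \<beta>"
    using countable_cord_bounded by blast
  then have ex: "\<exists>\<alpha>. \<forall>v. (w, v) \<in> R \<longrightarrow> rank v < \<alpha>"
    by auto
  have w: "w \<in> T"
    using assms R_subset by blast
  have "\<forall>v. (w, v) \<in> R \<longrightarrow> rank v < rank w"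
    using LeastI_ex[OF ex] unfolding rank_eq_Least[OF w, symmetric] .
  with assms show ?thesis
    by blast
qed

text \<open>Below a fixed height only finitely many ranks occur, so a limit is never reached.\<close>

lemma rank_not_limit:
  fixes m :: "'a \<Rightarrow> nat"
  assumes S: "S \<subseteq> T" "\<And>u v. u \<in> S \<Longrightarrow> (u, v) \<in> R \<Longrightarrow> v \<in> S \<and> m v < m u"
    and w: "w \<in> S"
  shows "\<not> limit_ordinal (rank w)"
proof
  assume lim: "limit_ordinal (rank w)"
  have "\<exists>F. finite F \<and> (\<forall>u\<in>S. m u < n \<longrightarrow> rank u \<in> F)" for n
  proof (induction n)
    case (Suc n)
    then obtain F where F: "finite F" "\<And>u. u \<in> S \<Longrightarrow> m u < n \<Longrightarrow> rank u \<in> F"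
      by blast
    \<comment> \<open>Ranks at the next height are least strict upper bounds of subsets of
      \<open>F\<close>, of which there are finitely many.\<close>
    let ?F = "(\<lambda>A. LEAST \<alpha>. \<forall>\<beta>\<in>A. \<beta> < \<alpha>) ` Pow F"
    have "rank u \<in> ?F" if "u \<in> S" "m u < Suc n" for u
    proof -
      have "rank ` (R `` {u}) \<subseteq> F"
        using F(2) S(2)[OF that(1)] that(2) by fastforce
      moreover have "(\<forall>v. (u, v) \<in> R \<longrightarrow> rank v < \<alpha>) \<longleftrightarrow> (\<forall>\<beta>\<in>rank ` (R `` {u}). \<beta> < \<alpha>)" for \<alpha>
        by auto
      then have "rank u = (LEAST \<alpha>. \<forall>\<beta>\<in>rank ` (R `` {u}). \<beta> < \<alpha>)"
        using rank_eq_Least[of u] S(1) that(1) by (simp only: subset_iff)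
      ultimately show ?thesis
        by blast
    qed
    then show ?case
      using F(1) by (intro exI[of _ ?F]) simp
  qed auto
  then obtain F where F: "finite F" "\<And>u. u \<in> S \<Longrightarrow> m u < m w \<Longrightarrow> rank u \<in> F"
    by meson
  let ?A = "rank ` (R `` {w})"
  have "?A \<subseteq> F"
    using F(2) S(2)[OF w] by blast
  then have fin: "finite ?A"
    using F(1) finite_subset by blast
  obtain \<beta> where "\<beta> < rank w"
    using lim unfolding limit_ordinal_def by blast
  then have "?A \<noteq> {}"
    using rank_le[of w \<beta>] S(1) w by fastforce
  \<comment> \<open>A limit leaves room between this maximum and \<open>rank w\<close>, but any
    \<gamma> in between already bounds all ranks above \<open>w\<close>.\<close>
  then have "Max ?A < rank w"
    using fin rank_less by simp
  then obtain \<gamma> where \<gamma>: "Max ?A < \<gamma>" "\<gamma> < rank w"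
    using lim unfolding limit_ordinal_def by blast
  have "rank v < \<gamma>" if "(w, v) \<in> R" for v
    using Max_ge[OF fin, of "rank v"] that \<gamma>(1) by auto
  then have "rank w \<le> \<gamma>"
    using S(1) w by (intro rank_le) auto
  with \<gamma>(2) show False
    by simp
qed

section \<open>Neighbourhoods in the bouquet topology\<close>

lemma topspace_bouquet: "topspace (bouquet_topology T R) = T"
  using tree_TR by (rule topspace_bouquet_topology)

lemma daughters_subset: "daughters R w \<subseteq> R `` {w}"
  by (auto simp: daughters_def)

text \<open>Induction over the generation of the topology. A generating set containing
  \<open>w\<close> contains everything above \<open>w\<close>, unless it is centred at
  \<open>w\<close> itself; such a set omits finitely many daughters and occurs only at limit
  rank.\<close>

lemma bouquet_open_cofinite:
  assumes "openin (bouquet_topology T R) U" "w \<in> U"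
  shows "(\<exists>D. finite D \<and> daughters R w - D \<subseteq> U) \<and>
    (\<not> limit_ordinal (rank w) \<longrightarrow> R `` {w} \<subseteq> U)"
  using assms unfolding bouquet_topology_def openin_topology_generated_by_iff
proof (induction U rule: generate_topology_on.induct)
  case (Int U V)
  then obtain D E where "finite D" "daughters R w - D \<subseteq> U" "finite E" "daughters R w - E \<subseteq> V"
    by blast
  then have "\<exists>D. finite D \<and> daughters R w - D \<subseteq> U \<inter> V"
    by (intro exI[of _ "D \<union> E"]) auto
  with Int show ?case
    by blast
next
  case (UN K)
  then obtain k where "k \<in> K" "w \<in> k"
    by blast
  with UN.IH[OF this] show ?case
    by blast
next
  case (Basis U)
  have up: ?case if "R `` {w} \<subseteq> U"
    using that daughters_subset[of w] by blast
  from Basis.hyps show ?case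
  proof
    assume "U \<in> {U. openin (upset_topology T R) U}"
    then show ?case
      using Basis.prems by (intro up) (auto simp: openin_upset_topology)
  next
    assume "U \<in> {{w} \<union> (\<Union>i\<in>{n<..}. {v i} \<union> R `` {v i}) | w n (v :: nat \<Rightarrow> 'a).
         w \<in> T \<and> limit_ordinal (rank w) \<and> bij_betw v UNIV (daughters R w)}"
    then obtain c n and v :: "nat \<Rightarrow> 'a"
      where U: "U = {c} \<union> (\<Union>i\<in>{n<..}. {v i} \<union> R `` {v i})"
        and c: "limit_ordinal (rank c)" "bij_betw v UNIV (daughters R c)"
      by blast
    show ?case
    proof (cases "w = c")
      case True
      have "daughters R w - v ` {..n} \<subseteq> U"
        using c(2) unfolding True U bij_betw_def by (force simp: not_le)
      then show ?thesis
        using True c(1) by blast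
    next
      case False
      then obtain i where "n < i" "w \<in> {v i} \<union> R `` {v i}"
        using Basis.prems unfolding U by blast
      then have "R `` {w} \<subseteq> U"
        using R_trans unfolding U by blast
      then show ?thesis
        by (rule up)
    qed
  qed
qed auto

text \<open>At such a point no smaller neighbourhoods are added: the cone is still the least
  one.\<close>

lemma bouquet_derived_nonlimit:
  assumes "w \<in> T" "\<not> limit_ordinal (rank w)"
  shows "w \<in> bouquet_topology T R derived_set_of A \<longleftrightarrow> (\<exists>v\<in>A. (w, v) \<in> R)"
proof
  assume w: "w \<in> bouquet_topology T R derived_set_of A"
  have "openin (bouquet_topology T R) ({w} \<union> R `` {w})"
    unfolding bouquet_topology_def openin_topology_generated_by_iff
    using openin_cone[OF assms(1)] by (intro generate_topology_on.Basis) auto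
  with w show "\<exists>v\<in>A. (w, v) \<in> R"
    unfolding in_derived_set_of by blast
next
  assume "\<exists>v\<in>A. (w, v) \<in> R"
  then obtain v where v: "v \<in> A" "(w, v) \<in> R"
    by blast
  have "v \<in> U" if "w \<in> U" "openin (bouquet_topology T R) U" for U
    using bouquet_open_cofinite[OF that(2,1)] assms(2) v(2) by blast
  moreover have "v \<noteq> w"
    using v(2) R_irrefl by blast
  ultimately show "w \<in> bouquet_topology T R derived_set_of A"
    using v(1) assms(1) unfolding in_derived_set_of topspace_bouquet by blast
qed

text \<open>The daughters are countable and infinite, so they have a bijective enumeration; cutting
  it off past the last index that falls in \<open>D\<close> gives the neighbourhood.\<close>

lemma bouquet_limit_neighbourhood:
  assumes "w \<in> T" "limit_ordinal (rank w)" "infinite (daughters R w)" "finite D"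
  shows "\<exists>U. openin (bouquet_topology T R) U \<and> w \<in> U \<and>
    U \<subseteq> {w} \<union> (\<Union>v\<in>daughters R w - D. {v} \<union> R `` {v})"
proof -
  have "countable (daughters R w)"
    using daughters_subset R_subset by (intro countable_subset[OF _ countable_T]) blast
  then obtain f :: "'a \<Rightarrow> nat" where "bij_betw f (daughters R w) UNIV"
    using assms(3) by (rule countableE_infinite)
  then obtain v :: "nat \<Rightarrow> 'a" where v: "bij_betw v UNIV (daughters R w)"
    using bij_betw_inv by blast
  have "finite (v -` D)"
    using v assms(4) by (intro finite_vimageI) (auto simp: bij_betw_def)
  then obtain n where n: "\<And>i. i \<in> v -` D \<Longrightarrow> i \<le> n"
    using finite_nat_set_iff_bounded_le by metis
  let ?U = "{w} \<union> (\<Union>i\<in>{n<..}. {v i} \<union> R `` {v i})"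
  have "openin (bouquet_topology T R) ?U"
    unfolding bouquet_topology_def openin_topology_generated_by_iff
    using assms(1,2) v by (intro generate_topology_on.Basis) blast
  moreover have "v i \<in> daughters R w - D" if "n < i" for i
    using v n[of i] that unfolding bij_betw_def by auto
  then have "?U \<subseteq> {w} \<union> (\<Union>v\<in>daughters R w - D. {v} \<union> R `` {v})"
    by blast
  ultimately show ?thesis
    by blast
qed

end


section \<open>Truth in bouquets of maximal consistent sets\<close>

definition sub_closed :: "'p fm set \<Rightarrow> bool" where
  "sub_closed F \<longleftrightarrow> (\<forall>\<phi>. Neg \<phi> \<in> F \<longrightarrow> \<phi> \<in> F) \<and> (\<forall>\<phi> \<psi>. Con \<phi> \<psi> \<in> F \<longrightarrow> \<phi> \<in> F \<and> \<psi> \<in> F) \<and>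
     (\<forall>\<phi>. Box \<phi> \<in> F \<longrightarrow> \<phi> \<in> F)"

lemma sub_closedD:
  assumes "sub_closed F"
  shows "Neg \<phi> \<in> F \<Longrightarrow> \<phi> \<in> F" "Con \<phi> \<psi> \<in> F \<Longrightarrow> \<phi> \<in> F" "Con \<phi> \<psi> \<in> F \<Longrightarrow> \<psi> \<in> F"
    "Box \<phi> \<in> F \<Longrightarrow> \<phi> \<in> F"
  using assms unfolding sub_closed_def by blast+

text \<open>
  On the part \<open>S\<close> of the tree, whose points have finite height \<open>m\<close>, the labels are only
  required to be saturated with respect to the formulae in \<open>F\<close>.
\<close>

locale canonical_tree = countable_tree T R
  for T :: "'a set" and R :: "'a rel" +
  fixes S :: "'a set" and lab F :: "'a \<Rightarrow> 'p fm set" and m :: "'a \<Rightarrow> nat"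
  assumes S_subset: "S \<subseteq> T"
    and S_up: "u \<in> S \<Longrightarrow> (u, v) \<in> R \<Longrightarrow> v \<in> S \<and> F v = F u \<and> m v < m u"
    and mcs: "w \<in> T \<Longrightarrow> MCS (lab w)"
    and closed: "w \<in> S \<Longrightarrow> sub_closed (F w)"
    and box_up: "(w, v) \<in> R \<Longrightarrow> Box \<chi> \<in> lab w \<Longrightarrow> \<chi> \<in> lab v"
    and box_witness: "w \<in> S \<Longrightarrow> Box \<psi> \<in> F w \<Longrightarrow> Box \<psi> \<notin> lab w \<Longrightarrow> \<exists>v. (w, v) \<in> R \<and> \<psi> \<notin> lab v"
begin

section \<open>Valuation and truth lemmas\<close>

definition val :: "'p \<Rightarrow> 'a set" where
  "val p = {w \<in> T. Var p \<in> lab w}"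

abbreviation sem :: "'p fm \<Rightarrow> 'a set" where
  "sem \<equiv> d_sem (bouquet_topology T R) val"

lemma d_valuation_val: "d_valuation (bouquet_topology T R) val"
  by (auto simp: d_valuation_def val_def topspace_bouquet)

lemma omega_bouquet: "omega_bouquet (bouquet_topology T R)"
  unfolding omega_bouquet_def using countable_T tree_TR wf_conv by blast

lemma S_not_limit: "w \<in> S \<Longrightarrow> \<not> limit_ordinal (rank w)"
  using S_subset S_up by (intro rank_not_limit[of S m]) auto

text \<open>Points of \<open>S\<close> have no limit rank, so boxes are evaluated along
  \<open>R\<close> as in relational semantics. \<open>F\<close> is constant along \<open>R\<close>
  on \<open>S\<close>, so subformulae stay within its scope.\<close>

lemma truth_S:
  assumes "w \<in> S" "\<phi> \<in> F w"
  shows "w \<in> sem \<phi> \<longleftrightarrow> \<phi> \<in> lab w"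
  using assms
proof (induction \<phi> arbitrary: w)
  case (Var p)
  then show ?case
    using S_subset by (auto simp: val_def)
next
  case Bot
  then show ?case
    using MCS_Bot mcs S_subset by auto
next
  case (Neg \<phi>)
  then have "\<phi> \<in> F w" "w \<in> T"
    using sub_closedD[OF closed] S_subset by blast+
  with Neg show ?case
    by (simp add: topspace_bouquet MCS_Neg mcs)
next
  case (Con \<phi> \<psi>)
  then have "\<phi> \<in> F w" "\<psi> \<in> F w" "w \<in> T"
    using sub_closedD[OF closed] S_subset by blast+
  with Con show ?case
    by (simp add: MCS_Con mcs)
next
  case (Box \<phi>)
  then have w: "\<phi> \<in> F w" "w \<in> T"
    using sub_closedD[OF closed] S_subset by blast+
  have "w \<in> sem (Box \<phi>) \<longleftrightarrow> (\<forall>v. (w, v) \<in> R \<longrightarrow> v \<in> sem \<phi>)"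
    using w R_subset bouquet_derived_nonlimit[OF w(2) S_not_limit[OF Box.prems(1)]]
    by (auto simp: topspace_bouquet)
  also have "\<dots> \<longleftrightarrow> (\<forall>v. (w, v) \<in> R \<longrightarrow> \<phi> \<in> lab v)"
    using Box.IH S_up[OF Box.prems(1)] w(1) by auto
  also have "\<dots> \<longleftrightarrow> Box \<phi> \<in> lab w"
    using box_up box_witness[OF Box.prems] by blast
  finally show ?case .
qed

text \<open>Failure of \<open>Box_power_Bot k\<close> yields a chain of \<open>k\<close> witnesses
  above \<open>u'\<close>, while \<open>m u < k\<close> allows only shorter chains above
  \<open>u\<close>. The induction compares every point above \<open>u\<close> with the first witness
  \<open>v\<close>.\<close>

lemma rank_less_if_Box_power_Bot:
  assumes "u \<in> S" "m u < k" "u' \<in> S" "Box_power_Bot k \<in> F u'" "Box_power_Bot k \<notin> lab u'"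
  shows "rank u < rank u'"
  using assms
proof (induction k arbitrary: u u')
  case (Suc k)
  obtain v where v: "(u', v) \<in> R" "Box_power_Bot k \<notin> lab v"
    using box_witness[OF Suc.prems(3)] Suc.prems(4,5) by auto
  have "v \<in> S" "Box_power_Bot k \<in> F v"
    using S_up[OF Suc.prems(3) v(1)] sub_closedD(4)[OF closed[OF Suc.prems(3)]] Suc.prems(4)
    by simp_all
  then have "rank x < rank v" if "(u, x) \<in> R" for x
    using S_up[OF Suc.prems(1) that] Suc.prems(2) v(2) by (intro Suc.IH) auto
  then have "rank u \<le> rank v"
    using Suc.prems(1) S_subset by (intro rank_le) auto
  also have "\<dots> < rank u'"
    using v(1) by (rule rank_less)
  finally show ?case .
qed simp

text \<open>The unbounded depth expressed by \<open>deep\<close> makes the rank of \<open>r\<close>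
  a limit, so neighbourhoods of \<open>r\<close> need only see almost all daughters. Hence finitely
  many exceptions to the truth lemma, as granted by \<open>unsat\<close>, can be discarded, and
  infinitely many refuting daughters, as granted by \<open>wit\<close>, cannot be avoided.\<close>

lemma truth_limit:
  assumes r: "r \<in> T" "R `` {r} \<subseteq> S"
    and unsat: "\<And>\<psi>. finite {v \<in> daughters R r. \<psi> \<notin> F v}"
    and wit: "\<And>\<psi>. Box \<psi> \<notin> lab r \<Longrightarrow> infinite {v \<in> daughters R r. \<psi> \<notin> lab v}"
    and deep: "\<And>k. Box_power_Bot k \<notin> lab r"
  shows "r \<in> sem \<phi> \<longleftrightarrow> \<phi> \<in> lab r"
proof -
  \<comment> \<open>Dropping the finitely many daughters whose fragment misses \<psi> leaves
    infinitely many to which \<open>truth_S\<close> applies.\<close>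
  have wit': "infinite {v \<in> daughters R r. \<psi> \<notin> lab v \<and> \<psi> \<in> F v}" if "Box \<psi> \<notin> lab r" for \<psi>
  proof
    assume "finite {v \<in> daughters R r. \<psi> \<notin> lab v \<and> \<psi> \<in> F v}"
    then have "finite ({v \<in> daughters R r. \<psi> \<notin> lab v \<and> \<psi> \<in> F v} \<union> {v \<in> daughters R r. \<psi> \<notin> F v})"
      using unsat by blast
    then have "finite {v \<in> daughters R r. \<psi> \<notin> lab v}"
      by (rule rev_finite_subset) blast
    with wit[OF that] show False ..
  qed
  have "Box Bot \<notin> lab r"
    using deep[of 1] by simp
  from wit[OF this] have inf: "infinite (daughters R r)"
    by (rule contrapos_nn) (rule rev_finite_subset, auto)
  then obtain v\<^sub>0 where v\<^sub>0: "(r, v\<^sub>0) \<in> R"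
    using daughters_subset[of r] infinite_imp_nonempty[OF inf] by blast
  have lim: "limit_ordinal (rank r)"
    unfolding limit_ordinal_def
  proof (intro conjI allI impI)
    show "\<exists>\<beta>. \<beta> < rank r"
      using rank_less[OF v\<^sub>0] by blast
    fix \<beta> assume "\<beta> < rank r"
    then obtain u where u: "(r, u) \<in> R" "\<beta> \<le> rank u"
      using rank_le[OF r(1), of \<beta>] by (meson not_le)
    \<comment> \<open>This exceeds the height bound of \<open>u\<close>, as the rank comparison
      demands; the next power, also absent from the label of \<open>r\<close>, supplies the daughter
      \<open>v\<close>.\<close>
    let ?k = "Suc (m u)"
    have "Box (Box_power_Bot ?k) \<notin> lab r"
      using deep[of "Suc ?k"] by simp
    from wit'[OF this] obtain v where "v \<in> {v \<in> daughters R r. Box_power_Bot ?k \<notin> lab v \<and> Box_power_Bot ?k \<in> F v}"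
      using infinite_imp_nonempty by blast
    then have v: "(r, v) \<in> R" "Box_power_Bot ?k \<notin> lab v" "Box_power_Bot ?k \<in> F v"
      using daughters_subset by blast+
    have "rank u < rank v"
      by (rule rank_less_if_Box_power_Bot[of _ ?k]) (use u v r in auto)
    then show "\<exists>\<gamma>>\<beta>. \<gamma> < rank r"
      using u(2) rank_less[OF v(1)] by (meson order_le_less_trans)
  qed
  show ?thesis
  proof (induction \<phi>)
    case (Var p)
    then show ?case
      using r by (auto simp: val_def)
  next
    case Bot
    then show ?case
      using MCS_Bot mcs r by auto
  next
    case (Neg \<phi>)
    then show ?case
      using r by (simp add: topspace_bouquet MCS_Neg mcs)
  next
    case (Con \<phi> \<psi>)
    then show ?case
      using r by (simp add: MCS_Con mcs)
  next
    case (Box \<phi>)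
    have "r \<notin> bouquet_topology T R derived_set_of (T - sem \<phi>)" if box: "Box \<phi> \<in> lab r"
    proof -
      \<comment> \<open>The daughters at which \<open>truth_S\<close> does not cover \<phi>; they
        are cut out of the neighbourhood.\<close>
      let ?D = "{v \<in> daughters R r. \<phi> \<notin> F v}"
      obtain U where U: "openin (bouquet_topology T R) U" "r \<in> U"
        "U \<subseteq> {r} \<union> (\<Union>v\<in>daughters R r - ?D. {v} \<union> R `` {v})"
        using bouquet_limit_neighbourhood[OF r(1) lim inf unsat] by blast
      have "u \<in> sem \<phi>" if "u \<in> U" "u \<noteq> r" for u
      proof -
        obtain v where v: "(r, v) \<in> R" "\<phi> \<in> F v" "u = v \<or> (v, u) \<in> R"
          using U(3) \<open>u \<in> U\<close> \<open>u \<noteq> r\<close> daughters_subset[of r] by fast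
        then have "(r, u) \<in> R" "u \<in> S" "F u = F v"
          using R_trans r(2) S_up[of v u] by blast+
        then show ?thesis
          using truth_S box_up[OF _ box] v(2) by auto
      qed
      then show ?thesis
        using U(1,2) unfolding in_derived_set_of by blast
    qed
    moreover have "r \<in> bouquet_topology T R derived_set_of (T - sem \<phi>)" if box: "Box \<phi> \<notin> lab r"
      unfolding in_derived_set_of topspace_bouquet
    proof (intro conjI allI impI)
      fix U assume "r \<in> U \<and> openin (bouquet_topology T R) U"
      then obtain D where D: "finite D" "daughters R r - D \<subseteq> U"
        using bouquet_open_cofinite[of U r] by auto
      \<comment> \<open>Removing the finite set \<open>D\<close> from the infinitely many daughters
        refuting \<phi> leaves at least one.\<close>
      obtain v where "v \<in> {v \<in> daughters R r. \<phi> \<notin> lab v \<and> \<phi> \<in> F v} - D"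
        using Diff_infinite_finite[OF D(1) wit'[OF box]] infinite_imp_nonempty by blast
      then have v: "v \<in> daughters R r - D" "(r, v) \<in> R" "\<phi> \<notin> lab v" "\<phi> \<in> F v"
        using daughters_subset by blast+
      then have "v \<in> T - sem \<phi>"
        using truth_S r(2) S_subset by blast
      moreover have "v \<noteq> r"
        using v(2) R_irrefl by blast
      ultimately show "\<exists>y. y \<noteq> r \<and> y \<in> T - sem \<phi> \<and> y \<in> U"
        using D(2) v(1) by blast
    qed (rule r(1))
    ultimately show ?case
      using r by (auto simp: topspace_bouquet)
  qed
qed

end


section \<open>The tree of witness sequences\<close>

text \<open>
  A step \<open>(n, \<psi>)\<close> moves to a maximal consistent set witnessing the failure of \<open>\<box>\<psi>\<close>; the index
  \<open>n\<close> is chosen at the first step and only formulae in \<open>F n\<close> are witnessed afterwards.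
\<close>

definition path_mcs :: "'p fm set \<Rightarrow> (nat \<times> 'p fm) list \<Rightarrow> 'p fm set" where
  "path_mcs \<Gamma> l = foldl (\<lambda>\<Delta> x. succ_mcs \<Delta> (snd x)) \<Gamma> l"

lemma path_mcs_simps [simp]:
  "path_mcs \<Gamma> [] = \<Gamma>" "path_mcs \<Gamma> (l @ [(n, \<psi>)]) = succ_mcs (path_mcs \<Gamma> l) \<psi>"
  by (simp_all add: path_mcs_def)

inductive_set paths :: "'p fm set \<Rightarrow> (nat \<Rightarrow> 'p fm set) \<Rightarrow> (nat \<times> 'p fm) list set"
  for \<Gamma> F where
  Nil: "[] \<in> paths \<Gamma> F"
| snoc: "l \<in> paths \<Gamma> F \<Longrightarrow> l \<noteq> [] \<longrightarrow> fst (last l) = n \<Longrightarrow> Box \<psi> \<in> F n \<Longrightarrow>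
     Box \<psi> \<notin> path_mcs \<Gamma> l \<Longrightarrow> l @ [(n, \<psi>)] \<in> paths \<Gamma> F"

lemma paths_snocD:
  assumes "l @ [(n, \<psi>)] \<in> paths \<Gamma> F"
  shows "l \<in> paths \<Gamma> F" "l \<noteq> [] \<Longrightarrow> fst (last l) = n" "Box \<psi> \<in> F n" "Box \<psi> \<notin> path_mcs \<Gamma> l"
  using assms by (auto elim: paths.cases)

lemma paths_prefix: "l \<in> paths \<Gamma> F \<Longrightarrow> prefix k l \<Longrightarrow> k \<in> paths \<Gamma> F"
  by (induction rule: paths.induct) (auto intro: paths.intros)

lemma path_mcs_MCS:
  assumes "MCS \<Gamma>" "l \<in> paths \<Gamma> F"
  shows "MCS (path_mcs \<Gamma> l)"
  using assms(2)
  by (induction rule: paths.induct)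
    (use assms(1) canonical_successor_succ_mcs in \<open>auto simp: canonical_successor_def\<close>)

lemma path_mcs_snoc:
  assumes "MCS \<Gamma>" "l @ [(n, \<psi>)] \<in> paths \<Gamma> F"
  shows "canonical_successor (path_mcs \<Gamma> l) \<psi> (path_mcs \<Gamma> (l @ [(n, \<psi>)]))"
  using path_mcs_MCS[OF assms(1)] paths_snocD[OF assms(2)]
  by (simp add: canonical_successor_succ_mcs)

lemma strict_prefix_snoc: "strict_prefix k (l @ [x]) \<longleftrightarrow> k = l \<or> strict_prefix k l"
  by (auto simp: strict_prefix_def)

lemma path_mcs_Box:
  assumes "MCS \<Gamma>" "l \<in> paths \<Gamma> F" "strict_prefix k l" "Box \<chi> \<in> path_mcs \<Gamma> k"
  shows "\<chi> \<in> path_mcs \<Gamma> l \<and> Box \<chi> \<in> path_mcs \<Gamma> l"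
  using assms(2-)
proof (induction rule: paths.induct)
  case (snoc l n \<psi>)
  then have "Box \<chi> \<in> path_mcs \<Gamma> l"
    by (auto simp: strict_prefix_snoc)
  moreover have "l @ [(n, \<psi>)] \<in> paths \<Gamma> F"
    using snoc.hyps by (rule paths.snoc)
  ultimately show ?case
    using path_mcs_snoc[OF assms(1)] unfolding canonical_successor_def by blast
qed simp

lemma paths_index:
  assumes "l \<in> paths \<Gamma> F" "strict_prefix k l" "k \<noteq> []"
  shows "fst (last l) = fst (last k)"
  using assms by (induction rule: paths.induct) (auto simp: strict_prefix_snoc)

text \<open>The one-step decrease propagates along prefixes because every nonempty path lies in
  \<open>S\<close>; only the root may be missing from it.\<close>

lemma paths_decreasing:
  fixes m :: "(nat \<times> 'p fm) list \<Rightarrow> nat"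
  assumes "l \<in> paths \<Gamma> F" "strict_prefix k l" "k \<in> S"
    and S: "paths \<Gamma> F - {[]} \<subseteq> S"
    and dec: "\<And>l n \<psi>. l \<in> S \<Longrightarrow> l @ [(n, \<psi>)] \<in> paths \<Gamma> F \<Longrightarrow> m (l @ [(n, \<psi>)]) < m l"
  shows "m l < m k"
  using assms(1-3)
proof (induction rule: paths.induct)
  case (snoc l n \<psi>)
  have new: "l @ [(n, \<psi>)] \<in> paths \<Gamma> F"
    using snoc.hyps by (rule paths.snoc)
  show ?case
  proof (cases "k = l")
    case True
    then show ?thesis
      using dec new snoc.prems by blast
  next
    case False
    then have *: "strict_prefix k l"
      using snoc.prems by (simp add: strict_prefix_snoc)
    then have "l \<in> S"
      using S snoc.hyps(1) by (cases l) auto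
    then show ?thesis
      using dec[OF _ new] snoc.IH[OF * snoc.prems(2)] by force
  qed
qed simp

text \<open>Natural numbers carry the tree, so that the type of points does not depend on the
  variables.\<close>

definition coded_paths :: "'p::countable fm set \<Rightarrow> (nat \<Rightarrow> 'p fm set) \<Rightarrow> nat set" where
  "coded_paths \<Gamma> F = to_nat ` paths \<Gamma> F"

definition coded_prefix :: "'p::countable fm set \<Rightarrow> (nat \<Rightarrow> 'p fm set) \<Rightarrow> nat rel" where
  "coded_prefix \<Gamma> F =
     {(to_nat k, to_nat l) | k l. k \<in> paths \<Gamma> F \<and> l \<in> paths \<Gamma> F \<and> strict_prefix k l}"

lemma coded_prefix_iff [simp]:
  "(to_nat k, to_nat l) \<in> coded_prefix \<Gamma> F \<longleftrightarrow>
     k \<in> paths \<Gamma> F \<and> l \<in> paths \<Gamma> F \<and> strict_prefix k l"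
  by (auto simp: coded_prefix_def)

lemma coded_prefixE:
  assumes "(u, v) \<in> coded_prefix \<Gamma> F"
  obtains k l where "u = to_nat k" "v = to_nat l" "k \<in> paths \<Gamma> F" "l \<in> paths \<Gamma> F" "strict_prefix k l"
  using assms by (auto simp: coded_prefix_def)

text \<open>Prefixes of one list are comparable, length makes their order well-founded, and the
  empty sequence is the root.\<close>

lemma tree_coded_paths: "tree (coded_paths \<Gamma> F) (coded_prefix \<Gamma> F)"
proof -
  let ?R = "coded_prefix \<Gamma> F"
  have tr: "trans ?R"
    by (rule transI) (auto simp: coded_prefix_def intro: prefix_order.less_trans)
  have irr: "irrefl ?R"
    by (auto simp: coded_prefix_def irrefl_def)
  have "?R \<subseteq> inv_image (measure length) (from_nat :: nat \<Rightarrow> (nat \<times> 'a fm) list)"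
    by (auto simp: coded_prefix_def dest: prefix_length_less)
  then have wf: "wf ?R"
    using wf_subset wf_inv_image wf_measure by blast
  have "well_order_on {v. (v, w) \<in> ?R} (Restr (?R\<^sup>=) {v. (v, w) \<in> ?R})" for w
  proof -
    let ?P = "{v. (v, w) \<in> ?R}"
    have "refl_on ?P (Restr (?R\<^sup>=) ?P)"
      by (auto simp: refl_on_def)
    moreover have "trans (Restr (?R\<^sup>=) ?P)"
      using tr by (intro trans_Restr) simp
    moreover have "antisym (Restr (?R\<^sup>=) ?P)"
      using tr irr unfolding antisym_def irrefl_def trans_def by blast
    moreover have "total_on ?P (Restr (?R\<^sup>=) ?P)"
    proof (rule total_onI)
      fix u v assume "u \<in> ?P" "v \<in> ?P" "u \<noteq> v"
      then obtain k l j :: "(nat \<times> 'a fm) list" where "u = to_nat k" "v = to_nat l" "k \<noteq> l"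
          "k \<in> paths \<Gamma> F" "l \<in> paths \<Gamma> F" "prefix k j" "prefix l j"
        by (auto elim!: coded_prefixE simp: strict_prefix_def)
      then have "(u, v) \<in> ?R \<or> (v, u) \<in> ?R"
        using prefix_same_cases[of k j l] by (auto simp: strict_prefix_def)
      then show "(u, v) \<in> Restr (?R\<^sup>=) ?P \<or> (v, u) \<in> Restr (?R\<^sup>=) ?P"
        using \<open>u \<in> ?P\<close> \<open>v \<in> ?P\<close> by blast
    qed
    moreover have "wf (Restr (?R\<^sup>=) ?P - Id)"
      by (rule wf_subset[OF wf]) blast
    ultimately show ?thesis
      by (auto simp: well_order_on_def linear_order_on_def partial_order_on_def preorder_on_def)
  qed
  moreover have "\<exists>!r. r \<in> coded_paths \<Gamma> F \<and> (\<forall>v. (v, r) \<notin> ?R)"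
  proof (rule ex1I[of _ "to_nat ([] :: (nat \<times> 'a fm) list)"])
    show "to_nat ([] :: (nat \<times> 'a fm) list) \<in> coded_paths \<Gamma> F \<and>
        (\<forall>v. (v, to_nat ([] :: (nat \<times> 'a fm) list)) \<notin> ?R)"
      by (auto simp: coded_paths_def coded_prefix_def intro: paths.Nil)
    fix r assume r: "r \<in> coded_paths \<Gamma> F \<and> (\<forall>v. (v, r) \<notin> ?R)"
    then obtain l where l: "r = to_nat l" "l \<in> paths \<Gamma> F"
      by (auto simp: coded_paths_def)
    have "\<not> strict_prefix [] l"
      using r l paths.Nil coded_prefix_iff by blast
    then show "r = to_nat ([] :: (nat \<times> 'a fm) list)"
      using l by (cases l) auto
  qed
  moreover have "?R \<subseteq> coded_paths \<Gamma> F \<times> coded_paths \<Gamma> F"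
    by (auto simp: coded_prefix_def coded_paths_def)
  ultimately show ?thesis
    using tr irr by (simp add: tree_def Let_def)
qed

text \<open>Prefix closure puts a one-step path strictly between the root and any path of length at
  least two.\<close>

lemma daughters_root:
  fixes \<Gamma> :: "'p::countable fm set"
  shows "daughters (coded_prefix \<Gamma> F) (to_nat ([] :: (nat \<times> 'p fm) list)) =
     (\<lambda>x. to_nat [x]) ` {(n, \<psi>). Box \<psi> \<in> F n \<and> Box \<psi> \<notin> \<Gamma>}" (is "?L = ?R")
proof
  show "?L \<subseteq> ?R"
  proof
    fix v assume v: "v \<in> ?L"
    then obtain l where l: "v = to_nat l" "l \<in> paths \<Gamma> F" "l \<noteq> []"
      by (auto simp: daughters_def elim!: coded_prefixE)
    then obtain x xs where "l = [x] @ xs"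
      by (cases l) auto
    then have x: "[x] \<in> paths \<Gamma> F"
      using l(2) paths_prefix by (meson prefixI)
    have "xs = []"
    proof (rule ccontr)
      assume "xs \<noteq> []"
      then have "strict_prefix [] [x]" "strict_prefix [x] l"
        using \<open>l = [x] @ xs\<close> by (auto simp: strict_prefix_def)
      then have "(to_nat ([] :: (nat \<times> 'p fm) list), to_nat [x]) \<in> coded_prefix \<Gamma> F"
          "(to_nat [x], v) \<in> coded_prefix \<Gamma> F"
        using x l paths.Nil by auto
      then show False
        using v unfolding daughters_def by blast
    qed
    then show "v \<in> ?R"
      using l \<open>l = [x] @ xs\<close> paths_snocD[of "[]" "fst x" "snd x" \<Gamma> F] by (cases x) auto
  qed
  show "?R \<subseteq> ?L"
  proof
    fix v assume "v \<in> ?R"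
    then obtain n \<psi> where v: "v = to_nat [(n, \<psi>)]" "Box \<psi> \<in> F n" "Box \<psi> \<notin> \<Gamma>"
      by auto
    then have "[(n, \<psi>)] \<in> paths \<Gamma> F"
      using paths.snoc[OF paths.Nil, of n \<psi> F \<Gamma>] by simp
    then show "v \<in> ?L"
      using v(1) paths.Nil[of \<Gamma> F]
      by (auto simp: daughters_def strict_prefix_snoc[of _ "[]", simplified] elim!: coded_prefixE)
  qed
qed

text \<open>Serves both cases of the construction: \<open>S\<close> is either all paths or all
  nonempty ones. Since \<open>last []\<close> is unspecified, admitting the root to \<open>S\<close>
  requires all \<open>F n\<close> to agree.\<close>

lemma canonical_tree_paths:
  fixes m :: "(nat \<times> 'p::countable fm) list \<Rightarrow> nat"
  assumes mcs: "MCS \<Gamma>" and F: "\<And>n. sub_closed (F n)"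
    and S: "paths \<Gamma> F - {[]} \<subseteq> S" "S \<subseteq> paths \<Gamma> F"
    and const: "[] \<in> S \<Longrightarrow> \<exists>A. \<forall>n. F n = A"
    and dec: "\<And>l n \<psi>. l \<in> S \<Longrightarrow> l @ [(n, \<psi>)] \<in> paths \<Gamma> F \<Longrightarrow> m (l @ [(n, \<psi>)]) < m l"
  shows "canonical_tree (coded_paths \<Gamma> F) (coded_prefix \<Gamma> F) (to_nat ` S)
    (\<lambda>w. path_mcs \<Gamma> (from_nat w)) (\<lambda>w. F (fst (last (from_nat w :: (nat \<times> 'p fm) list))))
    (\<lambda>w. m (from_nat w))"
proof unfold_locales
  let ?T = "coded_paths \<Gamma> F" and ?R = "coded_prefix \<Gamma> F"
  show "countable ?T"
    by simp
  show "tree ?T ?R"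
    by (rule tree_coded_paths)
  \<comment> \<open>The root may have no height, so the first coordinate ranks it over all nonempty
    paths; among those \<open>m\<close> decreases.\<close>
  let ?f = "\<lambda>w. let l = from_nat w :: (nat \<times> 'p fm) list in (if l = [] then 1 else 0 :: nat, if l = [] then 0 else m l)"
  have "?R\<inverse> \<subseteq> inv_image (less_than <*lex*> less_than) ?f"
  proof clarify
    fix u v assume "(u, v) \<in> ?R"
    then obtain k l where *: "u = to_nat k" "v = to_nat l" "k \<in> paths \<Gamma> F" "l \<in> paths \<Gamma> F" "strict_prefix k l"
      by (rule coded_prefixE)
    then have "l \<noteq> []"
      by auto
    moreover have "m l < m k" if "k \<noteq> []"
      by (rule paths_decreasing[OF *(4,5) _ S(1) dec]) (use that * S in auto)
    ultimately show "(v, u) \<in> inv_image (less_than <*lex*> less_than) ?f"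
      using * by (simp add: Let_def)
  qed
  then show "wf (?R\<inverse>)"
    by (rule wf_subset[OF wf_inv_image, rotated]) (simp add: wf_lex_prod)
  show "to_nat ` S \<subseteq> ?T"
    using S by (auto simp: coded_paths_def)
  show "v \<in> to_nat ` S \<and> F (fst (last (from_nat v :: (nat \<times> 'p fm) list))) = F (fst (last (from_nat u :: (nat \<times> 'p fm) list)))
      \<and> m (from_nat v) < m (from_nat u)" if u: "u \<in> to_nat ` S" and R: "(u, v) \<in> ?R" for u v
  proof -
    obtain k l where *: "u = to_nat k" "v = to_nat l" "k \<in> paths \<Gamma> F" "l \<in> paths \<Gamma> F" "strict_prefix k l"
      using R by (rule coded_prefixE)
    have k: "k \<in> S"
      using u *(1) by (metis from_nat_to_nat imageE)
    have "l \<noteq> []"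
      using *(5) by auto
    then have "v \<in> to_nat ` S"
      using *(2,4) S(1) by blast
    moreover have "F (fst (last l)) = F (fst (last k))"
      using paths_index[OF *(4,5)] const k by (cases "k = []") auto
    moreover have "m l < m k"
      using *(4,5) k S(1) dec by (rule paths_decreasing)
    ultimately show ?thesis
      using *(1,2) by simp
  qed
  show "MCS (path_mcs \<Gamma> (from_nat w))" if "w \<in> ?T" for w
    using that path_mcs_MCS[OF mcs] by (auto simp: coded_paths_def)
  show "sub_closed (F (fst (last (from_nat w :: (nat \<times> 'p fm) list))))" for w
    by (rule F)
  show "\<chi> \<in> path_mcs \<Gamma> (from_nat v)" if "(w, v) \<in> ?R" "Box \<chi> \<in> path_mcs \<Gamma> (from_nat w)" for w v \<chi>
    using that path_mcs_Box[OF mcs] by (auto elim!: coded_prefixE)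
  show "\<exists>v. (w, v) \<in> ?R \<and> \<psi> \<notin> path_mcs \<Gamma> (from_nat v)"
    if w: "w \<in> to_nat ` S" and \<psi>: "Box \<psi> \<in> F (fst (last (from_nat w :: (nat \<times> 'p fm) list)))"
      "Box \<psi> \<notin> path_mcs \<Gamma> (from_nat w)" for w \<psi>
  proof -
    obtain l where l: "w = to_nat l" "l \<in> paths \<Gamma> F"
      using w S by blast
    let ?l = "l @ [(fst (last l), \<psi>)]"
    have new: "?l \<in> paths \<Gamma> F"
      using l \<psi> by (intro paths.snoc) auto
    have "\<psi> \<notin> path_mcs \<Gamma> ?l"
      using path_mcs_snoc[OF mcs new] unfolding canonical_successor_def by blast
    moreover have "(w, to_nat ?l) \<in> ?R"
      using l new by (simp add: strict_prefix_snoc)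
    ultimately show ?thesis
      by (metis from_nat_to_nat)
  qed
qed


section \<open>Strong completeness\<close>

primrec subfm :: "'p fm \<Rightarrow> 'p fm set" where
  "subfm (Var p) = {Var p}"
| "subfm Bot = {Bot}"
| "subfm (Neg \<phi>) = insert (Neg \<phi>) (subfm \<phi>)"
| "subfm (Con \<phi> \<psi>) = insert (Con \<phi> \<psi>) (subfm \<phi> \<union> subfm \<psi>)"
| "subfm (Box \<phi>) = insert (Box \<phi>) (subfm \<phi>)"

lemma finite_subfm: "finite (subfm \<phi>)"
  by (induction \<phi>) auto

lemma subfm_refl: "\<phi> \<in> subfm \<phi>"
  by (cases \<phi>) auto

lemma subfm_trans: "\<psi> \<in> subfm \<phi> \<Longrightarrow> subfm \<psi> \<subseteq> subfm \<phi>"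
  by (induction \<phi>) auto

lemma sub_closed_subfm: "sub_closed (subfm \<phi>)"
  unfolding sub_closed_def
  using subfm_trans[of _ \<phi>] subfm_refl by fastforce

text \<open>These finite sets closed under subformulae increase with \<open>n\<close>, and each
  formula belongs to all but finitely many of them.\<close>

definition fragment :: "nat \<Rightarrow> 'p::countable fm set" where
  "fragment n = (\<Union>\<phi>\<in>{\<phi>. to_nat \<phi> < n}. subfm \<phi>)"

lemma finite_fragment: "finite (fragment n)"
proof -
  have "finite (to_nat -` {..<n} :: 'a fm set)"
    by (intro finite_vimageI) auto
  then show ?thesis
    unfolding fragment_def by (intro finite_UN_I) (auto simp: finite_subfm vimage_def)
qed

lemma sub_closed_fragment: "sub_closed (fragment n)"
  using sub_closed_subfm unfolding sub_closed_def fragment_def by blast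

lemma in_fragment: "to_nat \<phi> < n \<Longrightarrow> \<phi> \<in> fragment n"
  unfolding fragment_def using subfm_refl by blast

text \<open>With \<open>Box_power_Bot k\<close> at the root the height is bounded even when all
  formulae are witnessed, so the root belongs to \<open>S\<close> and \<open>truth_S\<close> applies
  to it.\<close>

lemma satisfiable_finite_depth:
  fixes \<Gamma> :: "'p::countable fm set"
  assumes root_mcs: "MCS \<Gamma>" and bounded: "Box_power_Bot k \<in> \<Gamma>"
  shows "\<exists>(X :: nat topology) (V :: 'p \<Rightarrow> nat set) x.
           omega_bouquet X \<and> d_valuation X V \<and> x \<in> topspace X \<and> (\<forall>\<phi>\<in>\<Gamma>. x \<in> d_sem X V \<phi>)"
proof -
  let ?F = "\<lambda>n :: nat. UNIV :: 'p fm set"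
  let ?P = "paths \<Gamma> ?F"
  \<comment> \<open>Passing to a successor strips one box off the power of \<open>Bot\<close> in the
    label, so the least such power measures the height.\<close>
  define m where "m l = (LEAST j. Box_power_Bot j \<in> path_mcs \<Gamma> l)" for l
  obtain k' where k': "k = Suc k'"
    using bounded MCS_Bot[OF root_mcs] by (cases k) auto
  have dec: "m (l @ [(n, \<psi>)]) < m l" if l: "l \<in> ?P" "l @ [(n, \<psi>)] \<in> ?P" for l n \<psi>
  proof -
    \<comment> \<open>The power at the root is inherited along the path, so the \<open>LEAST\<close>
      in \<open>m\<close> is attained.\<close>
    have "Box_power_Bot k \<in> path_mcs \<Gamma> l"
      using path_mcs_Box[OF root_mcs l(1), of "[]" "Box_power_Bot k'"] bounded k'
      by (cases "l = []") (auto simp: strict_prefix_def)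
    then have least: "Box_power_Bot (m l) \<in> path_mcs \<Gamma> l"
      unfolding m_def by (rule LeastI)
    then obtain j where j: "m l = Suc j"
      using MCS_Bot[OF path_mcs_MCS[OF root_mcs l(1)]] by (cases "m l") auto
    then have "Box_power_Bot j \<in> path_mcs \<Gamma> (l @ [(n, \<psi>)])"
      using path_mcs_snoc[OF root_mcs l(2)] least unfolding canonical_successor_def by simp
    then have "m (l @ [(n, \<psi>)]) \<le> j"
      unfolding m_def by (rule Least_le)
    with j show ?thesis
      by simp
  qed
  interpret canonical_tree "coded_paths \<Gamma> ?F" "coded_prefix \<Gamma> ?F" "to_nat ` ?P"
    "\<lambda>w. path_mcs \<Gamma> (from_nat w)" "\<lambda>w. UNIV" "\<lambda>w. m (from_nat w)"
    using dec by (intro canonical_tree_paths[OF root_mcs]) (auto simp: sub_closed_def)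
  let ?r = "to_nat ([] :: (nat \<times> 'p fm) list)"
  have "?r \<in> to_nat ` ?P"
    using paths.Nil by blast
  then have "?r \<in> sem \<phi>" if "\<phi> \<in> \<Gamma>" for \<phi>
    using truth_S[of ?r \<phi>] that by simp
  moreover have "?r \<in> coded_paths \<Gamma> ?F"
    using paths.Nil by (auto simp: coded_paths_def)
  ultimately show ?thesis
    using omega_bouquet d_valuation_val topspace_bouquet by blast
qed

text \<open>The root carries all fragments at once, so it stays outside \<open>S\<close> and is
  treated by \<open>truth_limit\<close>; each branch above it works within a single finite
  fragment.\<close>

lemma satisfiable_infinite_depth:
  fixes \<Gamma> :: "'p::countable fm set"
  assumes root_mcs: "MCS \<Gamma>" and deep: "\<And>k. Box_power_Bot k \<notin> \<Gamma>"
  shows "\<exists>(X :: nat topology) (V :: 'p \<Rightarrow> nat set) x.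
           omega_bouquet X \<and> d_valuation X V \<and> x \<in> topspace X \<and> (\<forall>\<phi>\<in>\<Gamma>. x \<in> d_sem X V \<phi>)"
proof -
  let ?P = "paths \<Gamma> fragment"
  \<comment> \<open>Boxes of the fragment that are still refuted: each step makes its own box true
    and keeps the true ones, so their number strictly decreases.\<close>
  define boxes where "boxes l = {\<phi> \<in> fragment (fst (last l)). \<phi> \<in> range Box \<and> \<phi> \<notin> path_mcs \<Gamma> l}"
    for l :: "(nat \<times> 'p fm) list"
  define m where "m l = card (boxes l)" for l
  have dec: "m (l @ [(n, \<psi>)]) < m l" if "l \<in> ?P - {[]}" "l @ [(n, \<psi>)] \<in> ?P" for l n \<psi>
    unfolding m_def
  proof (rule psubset_card_mono)
    show "finite (boxes l)"
      unfolding boxes_def by (rule finite_subset[OF _ finite_fragment]) blast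
    have "n = fst (last l)" "Box \<psi> \<in> boxes l"
      using paths_snocD[OF that(2)] that(1) by (auto simp: boxes_def)
    then show "boxes (l @ [(n, \<psi>)]) \<subset> boxes l"
      using path_mcs_snoc[OF root_mcs that(2)] unfolding boxes_def canonical_successor_def by auto
  qed
  interpret canonical_tree "coded_paths \<Gamma> fragment" "coded_prefix \<Gamma> fragment" "to_nat ` (?P - {[]})"
    "\<lambda>w. path_mcs \<Gamma> (from_nat w)" "\<lambda>w. fragment (fst (last (from_nat w :: (nat \<times> 'p fm) list)))"
    "\<lambda>w. m (from_nat w)"
    using dec by (intro canonical_tree_paths[OF root_mcs sub_closed_fragment]) auto
  let ?r = "to_nat ([] :: (nat \<times> 'p fm) list)"
  let ?D = "daughters (coded_prefix \<Gamma> fragment) ?r"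
  have r: "?r \<in> coded_paths \<Gamma> fragment"
    using paths.Nil by (auto simp: coded_paths_def)
  have unsat: "finite {v \<in> ?D. \<psi> \<notin> fragment (fst (last (from_nat v :: (nat \<times> 'p fm) list)))}" for \<psi>
  proof (rule finite_subset)
    \<comment> \<open>A daughter \<open>[(n, \<chi>)]\<close> can miss \<psi> only for
      \<open>n\<close> up to \<open>to_nat \<psi>\<close>, and each finite fragment offers finitely
      many \<chi>.\<close>
    let ?A = "\<Union>n\<in>{..to_nat \<psi>}. {n} \<times> {\<chi>. Box \<chi> \<in> (fragment n :: 'p fm set)}"
    have "finite {\<chi>. Box \<chi> \<in> (fragment n :: 'p fm set)}" for n
      using finite_vimageI[OF finite_fragment, of Box n] by (auto simp: inj_def vimage_def)
    then show "finite ((\<lambda>x. to_nat [x]) ` ?A)"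
      by (intro finite_imageI finite_UN_I) auto
    show "{v \<in> ?D. \<psi> \<notin> fragment (fst (last (from_nat v :: (nat \<times> 'p fm) list)))} \<subseteq> (\<lambda>x. to_nat [x]) ` ?A"
      using in_fragment[of \<psi>] unfolding daughters_root by (auto simp: not_less[symmetric] image_iff)
  qed
  have wit: "infinite {v \<in> ?D. \<psi> \<notin> path_mcs \<Gamma> (from_nat v)}" if \<psi>: "Box \<psi> \<notin> path_mcs \<Gamma> (from_nat ?r)" for \<psi>
  proof -
    \<comment> \<open>Every \<open>n\<close> past the code of \<open>Box \<psi>\<close> contributes
      a refuting daughter; the index keeps these daughters distinct although their labels
      coincide.\<close>
    let ?g = "\<lambda>n. to_nat [(n, \<psi>)]"
    have "infinite (?g ` {to_nat (Box \<psi>)<..})"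
      by (subst finite_image_iff) (auto simp: inj_on_def infinite_Ioi)
    moreover have "?g n \<in> {v \<in> ?D. \<psi> \<notin> path_mcs \<Gamma> (from_nat v)}" if "n > to_nat (Box \<psi>)" for n
    proof -
      have "Box \<psi> \<in> fragment n" "Box \<psi> \<notin> \<Gamma>"
        using \<psi> in_fragment that by auto
      moreover from this have "[] @ [(n, \<psi>)] \<in> ?P"
        by (intro paths.intros) auto
      from path_mcs_snoc[OF root_mcs this] have "\<psi> \<notin> path_mcs \<Gamma> [(n, \<psi>)]"
        by (simp add: canonical_successor_def)
      ultimately show ?thesis
        unfolding daughters_root by auto
    qed
    ultimately show ?thesis
      using infinite_super[of "?g ` {to_nat (Box \<psi>)<..}"] by blast
  qed
  have "coded_prefix \<Gamma> fragment `` {?r} \<subseteq> to_nat ` (?P - {[]})"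
    by (auto elim!: coded_prefixE)
  from truth_limit[OF r this unsat wit] have "?r \<in> sem \<phi>" if "\<phi> \<in> \<Gamma>" for \<phi>
    using that deep by simp
  then show ?thesis
    using omega_bouquet d_valuation_val topspace_bouquet r by blast
qed

theorem theorem4p9:
  fixes \<Gamma> :: "'p::countable fm set"
  assumes "GL_consistent \<Gamma>"
  shows "\<exists>(X :: nat topology) (V :: 'p \<Rightarrow> nat set) x.
           omega_bouquet X \<and> d_valuation X V \<and> x \<in> topspace X \<and>
           (\<forall>\<phi>\<in>\<Gamma>. x \<in> d_sem X V \<phi>)"
proof -
  obtain \<Delta> where "\<Gamma> \<subseteq> \<Delta>" "MCS \<Delta>"
    using Lindenbaum[OF assms] by blast
  moreover have "\<exists>(X :: nat topology) (V :: 'p \<Rightarrow> nat set) x.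
      omega_bouquet X \<and> d_valuation X V \<and> x \<in> topspace X \<and> (\<forall>\<phi>\<in>\<Delta>. x \<in> d_sem X V \<phi>)"
    using satisfiable_finite_depth[OF \<open>MCS \<Delta>\<close>] satisfiable_infinite_depth[OF \<open>MCS \<Delta>\<close>] by blast
  ultimately show ?thesis
    by (meson subsetD)
qed

end
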